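(* Let $p_{-1}(s)=0$, $p_0(s)=1$ and, for $i\ge 0$, $$p_{i+1}(s)=(s^{q^i}-1)p_i(s)+\frac{T^{q^i-1}-1}{T^{q^i-1}}s^{q^i}p_{i-1}(s)\in\mathbb{F}_q(T)[s].$$ Let $L\in\mathbb{F}_q[T]$, $L\neq T$, be a prime element of degree $d\ge 1$. The Drinfeld module given by $\phi_T=u\tau^2+(u+T)\tau+T$ is supersingular for the prime $L$ if and only if $p_d(-u/T^q)\equiv 0\pmod L$.
   Context: $\mathbb{F}_q$ is a finite field, $\tau$ is the $q$-Frobenius; a prime element of $\mathbb{F}_q[T]$ means a monic irreducible polynomial; $\mathbb{F}_L=\mathbb{F}_q[T]/(L)$ and $\alpha\in\mathbb{F}_L$ is the class of $T$. The statement concerns the module in characteristic $L$: for $u\in\overline{\mathbb{F}}_L\setminus\{0\}$, consider the rank two Drinfeld $\mathbb{F}_q[T]$-module over $\overline{\mathbb{F}}_L$ given by $\phi_T=u\tau^2+(u+\alpha)\tau+\alpha$; it is supersingular if it has no nonzero $L$-torsion points over $\overline{\mathbb{F}}_L$ (i.e. $\phi_L$ is purely inseparable). The condition $p_d(-u/T^q)\equiv0\pmod L$ means $p_d^{(L)}(-u/\alpha^q)=0$, where $p_d^{(L)}\in\mathbb{F}_L[s]$ is the reduction of $p_d$ modulo $L$ (the coefficients of $p_d$ lie in $\mathbb{F}_q[T,1/T]$). *)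

theory Defs
  imports "HOL-Library.Cardinality" "HOL-Computational_Algebra.Computational_Algebra"
begin

text \<open>
  Throughout, \<open>'a\<close> is the finite field $F_q$ with \<open>q = CARD('a)\<close>, the ring $F_q[T]$ is
  \<open>'a poly\<close>, and \<open>'k\<close> is a field with a structure morphism
  \<open>\<gamma> :: 'a poly \<Rightarrow> 'k\<close>.
\<close>

abbreviation var_T :: "'a :: field poly" where
  "var_T \<equiv> [:0, 1:]"

text \<open>
  \<open>'k\<close> is an algebraic closure of $F_q[T]/(L)$: the morphism \<open>\<gamma>\<close> has kernel $(L)$, so that
  its range is a copy of $F_q[T]/(L)$ in which \<open>\<gamma> a\<close> is the class of \<open>a\<close>, and every element of
  the algebraically closed field \<open>'k\<close> is algebraic over that range.
\<close>

definition residue_field_closure ::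
    "'a :: {finite, field} poly \<Rightarrow> ('a poly \<Rightarrow> 'k :: alg_closed_field) \<Rightarrow> bool" where
  "residue_field_closure L \<gamma> \<longleftrightarrow>
     \<gamma> 1 = 1 \<and>
     (\<forall>a b. \<gamma> (a + b) = \<gamma> a + \<gamma> b) \<and>
     (\<forall>a b. \<gamma> (a * b) = \<gamma> a * \<gamma> b) \<and>
     (\<forall>a. \<gamma> a = 0 \<longleftrightarrow> L dvd a) \<and>
     (\<forall>x. \<exists>f. f \<noteq> 0 \<and> (\<forall>i. coeff f i \<in> range \<gamma>) \<and> poly f x = 0)"

text \<open>
  The twisted polynomial ring $k\{\tau\}$ with $\tau c = c^q \tau$: the element
  $\sum_i c_i \tau^i$ is stored as the coefficient sequence of a \<open>'k poly\<close>, with the addition of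
  \<open>'k poly\<close>, but with its own product and its own action on \<open>'k\<close>, in which $\tau$ acts as the
  \<open>q\<close>-Frobenius.
\<close>

definition twisted_mult :: "nat \<Rightarrow> 'k :: field poly \<Rightarrow> 'k poly \<Rightarrow> 'k poly" where
  "twisted_mult q f g =
     (\<Sum>i\<le>degree f. \<Sum>j\<le>degree g. monom (coeff f i * coeff g j ^ (q ^ i)) (i + j))"

definition twisted_apply :: "nat \<Rightarrow> 'k :: field poly \<Rightarrow> 'k \<Rightarrow> 'k" where
  "twisted_apply q f x = (\<Sum>i\<le>degree f. coeff f i * x ^ (q ^ i))"

text \<open>
  A Drinfeld module is a homomorphism of $F_q$-algebras $F_q[T] \to k\{\tau\}$ whose constant
  terms are given by \<open>\<gamma>\<close> and whose image is not contained in $k$.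
\<close>

definition drinfeld_module ::
    "('a :: {finite, field} poly \<Rightarrow> 'k :: field) \<Rightarrow> ('a poly \<Rightarrow> 'k poly) \<Rightarrow> bool" where
  "drinfeld_module \<gamma> \<phi> \<longleftrightarrow>
     (\<forall>c. \<phi> [:c:] = [:\<gamma> [:c:]:]) \<and>
     (\<forall>a b. \<phi> (a + b) = \<phi> a + \<phi> b) \<and>
     (\<forall>a b. \<phi> (a * b) = twisted_mult CARD('a) (\<phi> a) (\<phi> b)) \<and>
     (\<forall>a. coeff (\<phi> a) 0 = \<gamma> a) \<and>
     (\<exists>a. degree (\<phi> a) > 0)"

definition supersingular ::
    "('a :: {finite, field} poly \<Rightarrow> 'k :: field poly) \<Rightarrow> 'a poly \<Rightarrow> bool" where
  "supersingular \<phi> L \<longleftrightarrow> (\<forall>x. twisted_apply CARD('a) (\<phi> L) x = 0 \<longrightarrow> x = 0)"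

definition T_fract :: "'a :: field poly fract" where
  "T_fract = Fract var_T 1"

text \<open>The summand for \<open>i = 0\<close> below is $p_{-1} = 0$.\<close>

fun p_poly :: "nat \<Rightarrow> 'a :: {finite, field} poly fract poly" where
  "p_poly 0 = 1"
| "p_poly (Suc i) =
     (monom 1 (CARD('a) ^ i) - 1) * p_poly i +
     monom ((T_fract ^ (CARD('a) ^ i - 1) - 1) / T_fract ^ (CARD('a) ^ i - 1)) (CARD('a) ^ i) *
     (case i of 0 \<Rightarrow> 0 | Suc j \<Rightarrow> p_poly j)"

text \<open>
  Reduction modulo the kernel of \<open>\<gamma>\<close>, meaningful for those fractions that have a representation
  with denominator outside the kernel. For kernel $(L)$ and \<open>L \<noteq> T\<close> this covers
  $F_q[T, 1/T]$, which contains all coefficients of \<open>p_poly i\<close>.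
\<close>

definition reduce :: "('a :: field poly \<Rightarrow> 'k :: field) \<Rightarrow> 'a poly fract \<Rightarrow> 'k" where
  "reduce \<gamma> x = (THE y. \<exists>a b. x = Fract a b \<and> \<gamma> b \<noteq> 0 \<and> y = \<gamma> a / \<gamma> b)"

end

theory Submission
  imports Defs
begin

text \<open>
  Write \<open>\<alpha>\<close> for the class of \<open>T\<close> and \<open>\<star>\<close> for the product of twisted polynomials. The module in
  question factors as \<open>\<phi>\<^sub>T = (u\<tau> + \<alpha>) \<star> (\<tau> + 1)\<close>, so right multiplication by \<open>\<tau> + 1\<close> relates it to
  the module \<open>\<psi>\<close> with
  \<open>\<psi>\<^sub>T = (\<tau> + 1) \<star> (u\<tau> + \<alpha>) = u\<^sup>q\<tau>\<^sup>2 + (u + \<alpha>\<^sup>q)\<tau> + \<alpha>\<close>. Over a base of generic characteristic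
  \<open>\<psi>\<close> would have a logarithm \<open>\<Lambda>\<close>, a power series in \<open>\<tau>\<close> with \<open>\<Lambda> \<star> \<psi>\<^sub>T = T \<Lambda>\<close>. Comparing
  coefficients in this equation yields a three-term recursion which divides by \<open>\<alpha> - \<alpha>^(q^i)\<close> in
  step \<open>i\<close>. With \<open>s = -u/\<alpha>\<^sup>q\<close> it is, after clearing these denominators, exactly the recursion of
  the \<open>p\<^sub>i(s)\<close>. In characteristic \<open>L\<close> the denominators are nonzero for \<open>0 < i < d\<close> and vanish for
  \<open>i = d\<close>. Hence the logarithm exists up to \<open>\<tau>^(d-1)\<close>, and \<open>p\<^sub>d(s)\<close> is the obstruction to one more
  step: the truncated \<open>\<Lambda>\<close> satisfies \<open>\<Lambda> \<star> \<psi>\<^sub>T = \<alpha> \<Lambda> + h \<tau>^d\<close> modulo \<open>\<tau>^(d+1)\<close>, where \<open>h\<close> is a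
  nonzero multiple of \<open>p\<^sub>d(s)\<close>. Multiplying by \<open>\<tau> + 1\<close> on the right gives the same
  congruence for \<open>\<phi>\<close>, with \<open>\<Lambda> \<star> (\<tau> + 1)\<close> in place of \<open>\<Lambda>\<close>; from now on this is called \<open>\<Lambda>\<close>.

  As \<open>\<tau>^d\<close> commutes with \<open>\<alpha>\<close>, iterating the congruence gives
  \<open>\<Lambda> \<star> \<phi>\<^sub>a = \<gamma>(a) \<Lambda> + \<gamma>(a') h \<tau>^d\<close> modulo \<open>\<tau>^(d+1)\<close> for every \<open>a\<close> with derivative \<open>a'\<close>
  (\<open>coeff_eigen_mod_degree\<close>). For \<open>a = L\<close> the first term disappears and \<open>\<gamma>(L')\<close> is nonzero, because
  the \<open>d\<close> conjugates \<open>\<alpha>^(q^i)\<close> are distinct roots of \<open>L\<close>. Since \<open>\<Lambda>\<close> has constant term \<open>1\<close>, the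
  polynomial \<open>\<phi>\<^sub>L\<close> begins in degree \<open>d\<close> or later, and its coefficient there vanishes if and only if
  \<open>p\<^sub>d(s) = 0\<close> (\<open>\<phi>_L_hasse\<close>).

  It remains to compare with supersingularity. Over an algebraically closed field a twisted
  polynomial has trivial kernel if and only if it is a monomial (\<open>twisted_kernel_trivial_iff\<close>), and
  \<open>\<phi>\<^sub>L\<close> has degree \<open>2 d\<close>. If the lowest term of \<open>\<phi>\<^sub>L\<close> has degree \<open>m\<close>, then \<open>\<alpha>^(q^m) = \<alpha>\<close>, because
  \<open>\<phi>\<^sub>L\<close> and \<open>\<phi>\<^sub>T\<close> commute, and therefore \<open>d\<close> divides \<open>m\<close>. So the lowest term has degree \<open>d\<close> or
  \<open>2 d\<close>, and the kernel is trivial precisely when the coefficient of \<open>\<tau>^d\<close> vanishes.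
\<close>

section \<open>The Frobenius on algebras over a finite field\<close>

lemma finite_field_power_CARD:
  fixes c :: "'a :: {finite, field}"
  shows "c ^ CARD('a) = c"
proof (cases "c = 0")
  case False
  have "c * (\<Prod>y\<in>UNIV-{0}. c * y) = c * c ^ (CARD('a) - 1) * \<Prod>(UNIV-{0})"
    by (simp add: prod.distrib mult_ac)
  also have "c * c ^ (CARD('a) - 1) = c ^ CARD('a)"
    by (subst power_Suc [symmetric]) (simp add: zero_less_card_finite)
  also have "(\<Prod>y\<in>UNIV-{0}. c * y) = (\<Prod>y\<in>UNIV-{0}. y)"
    by (rule prod.reindex_bij_witness [of _ "\<lambda>y. y / c" "\<lambda>y. c * y"]) (use False in auto)
  finally show ?thesis
    by simp
qed (simp add: zero_less_card_finite)

lemma CARD_field_ge_2: "CARD('a :: {finite, field}) \<ge> 2"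
proof -
  have "card {0, 1 :: 'a} \<le> CARD('a)"
    by (intro card_mono) auto
  then show ?thesis
    by simp
qed

locale Fq_algebra =
  fixes q :: nat and \<gamma> :: "'a :: {finite, field} poly \<Rightarrow> 'k :: field"
  assumes q_eq: "q = CARD('a)"
    and hom_1 [simp]: "\<gamma> 1 = 1"
    and hom_add [simp]: "\<gamma> (a + b) = \<gamma> a + \<gamma> b"
    and hom_mult [simp]: "\<gamma> (a * b) = \<gamma> a * \<gamma> b"
begin

abbreviation \<alpha> :: 'k where "\<alpha> \<equiv> \<gamma> var_T"

lemma q_pos: "q > 0" and q_gt_1: "q > 1"
  using CARD_field_ge_2 [where ?'a = 'a] q_eq by linarith+

lemma hom_0 [simp]: "\<gamma> 0 = 0"
proof -
  have "\<gamma> 0 + \<gamma> 0 = \<gamma> 0 + 0"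
    by (simp flip: hom_add)
  then show ?thesis
    by (simp only: add_left_cancel)
qed

lemma hom_uminus [simp]: "\<gamma> (- a) = - \<gamma> a"
  using hom_add [of a "- a"] by (simp add: eq_neg_iff_add_eq_0 add.commute)

lemma hom_diff [simp]: "\<gamma> (a - b) = \<gamma> a - \<gamma> b"
  using hom_add [of a "- b"] by simp

lemma hom_power [simp]: "\<gamma> (a ^ n) = \<gamma> a ^ n"
  by (induction n) auto

lemma hom_const_power: "\<gamma> [:c:] ^ q ^ n = \<gamma> [:c:]"
proof (induction n)
  case (Suc n)
  have "\<gamma> [:c:] ^ q = \<gamma> [:c:]"
    by (simp add: poly_const_pow q_eq finite_field_power_CARD flip: hom_power)
  with Suc show ?case
    by (simp add: power_mult)
qed simp

lemma inj_hom_const: "inj (\<lambda>c. \<gamma> [:c:])"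
proof (rule injI, rule ccontr)
  fix c d assume eq: "\<gamma> [:c:] = \<gamma> [:d:]" and "c \<noteq> d"
  then have "1 = \<gamma> ([:c - d:] * [:inverse (c - d):])"
    by (simp del: hom_mult add: one_pCons [symmetric])
  also have "\<dots> = \<gamma> ([:c:] - [:d:]) * \<gamma> [:inverse (c - d):]"
    unfolding hom_mult by (simp flip: hom_diff)
  finally show False
    using eq by (simp only: hom_diff) simp
qed

text \<open>
  Over the base field itself \<open>c ^ q = c\<close>, so \<open>(X + 1) ^ q\<close> and \<open>X ^ q + 1\<close> agree at \<open>q\<close> points.
  Both are monic of degree \<open>q\<close>, so they are equal as polynomials.
\<close>

lemma frobenius_add_1: "(x + 1) ^ q = x ^ q + (1 :: 'k)"
proof -
  have "[:1, 1:] ^ q = monom 1 q + (1 :: 'k poly)"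
  proof (rule poly_eqI_degree_lead_coeff [where A = "range (\<lambda>c. \<gamma> [:c:])" and n = q])
    have "coeff ([:1, 1:] ^ q) q = (1 :: 'k)"
      using lead_coeff_power [of "[:1, 1 :: 'k:]" q] by (simp add: degree_power_eq)
    then show "coeff ([:1, 1:] ^ q) q = coeff (monom 1 q + (1 :: 'k poly)) q"
      using q_pos by simp
    show "q \<le> card (range (\<lambda>c. \<gamma> [:c:]))"
      by (simp add: card_image inj_hom_const q_eq)
    show "degree (monom 1 q + (1 :: 'k poly)) \<le> q"
      by (intro degree_add_le) (auto simp: degree_monom_le)
    fix z assume "z \<in> range (\<lambda>c. \<gamma> [:c:])"
    then obtain c where z: "z = \<gamma> [:c:]"
      by auto
    have "\<gamma> [:c + 1:] = 1 + z"
      using hom_add [of "[:c:]" 1] unfolding z hom_1 by (simp add: one_pCons del: hom_add)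
    then have "(1 + z) ^ q = 1 + z"
      using hom_const_power [of "c + 1" 1] by simp
    moreover have "z ^ q = z"
      using hom_const_power [of c 1] z by simp
    ultimately show "poly ([:1, 1:] ^ q) z = poly (monom 1 q + 1) z"
      by (simp add: poly_monom)
  qed (simp add: degree_power_eq)
  from arg_cong [OF this, of "\<lambda>p. poly p x"] show ?thesis
    by (simp add: poly_monom add.commute)
qed

lemma frobenius_add: "(x + y) ^ q = x ^ q + (y :: 'k) ^ q"
proof (cases "y = 0")
  case False
  then have "(x + y) ^ q = ((x / y + 1) * y) ^ q"
    by (simp add: distrib_right)
  also have "\<dots> = (x / y) ^ q * y ^ q + y ^ q"
    unfolding power_mult_distrib frobenius_add_1 by (simp add: distrib_right)
  also have "(x / y) ^ q * y ^ q = x ^ q"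
    using False by (simp add: power_divide)
  finally show ?thesis .
qed (simp add: q_pos)

lemma frobenius_power_add: "(x + y) ^ q ^ n = x ^ q ^ n + (y :: 'k) ^ q ^ n"
proof (induction n)
  case (Suc n)
  have "(x + y) ^ q ^ Suc n = ((x + y) ^ q ^ n) ^ q"
    by (simp only: power_Suc2 power_mult)
  also have "\<dots> = (x ^ q ^ n) ^ q + (y ^ q ^ n) ^ q"
    by (simp only: Suc frobenius_add)
  finally show ?case
    by (simp only: power_Suc2 power_mult)
qed simp

lemma frobenius_power_0 [simp]: "(0 :: 'k) ^ q ^ n = 0"
  using q_pos by simp

lemma frobenius_power_uminus: "(- x) ^ q ^ n = - ((x :: 'k) ^ q ^ n)"
  using frobenius_power_add [of x "- x" n] by (simp add: eq_neg_iff_add_eq_0 add.commute)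

lemma frobenius_power_diff: "(x - y) ^ q ^ n = x ^ q ^ n - (y :: 'k) ^ q ^ n"
  using frobenius_power_add [of x "- y" n] by (simp add: frobenius_power_uminus)

lemma frobenius_power_sum: "(\<Sum>i\<in>A. f i) ^ q ^ n = (\<Sum>i\<in>A. (f i :: 'k) ^ q ^ n)"
  by (induction A rule: infinite_finite_induct) (auto simp: frobenius_power_add)

lemma frobenius_power_inj: "x ^ q ^ n = (y :: 'k) ^ q ^ n \<Longrightarrow> x = y"
  using frobenius_power_diff [of x y n] by simp

lemma frobenius_power_comp: "((x :: 'k) ^ q ^ i) ^ q ^ j = x ^ q ^ (i + j)"
  by (simp only: power_add power_mult)

text \<open>
  A polynomial \<open>a\<close> enters both as a function on \<open>'k\<close>, encoded here, and through its class \<open>\<gamma> a\<close>,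
  which is the value of this function at \<open>\<alpha>\<close>.
\<close>

definition hom_coeffs :: "'a poly \<Rightarrow> 'k poly"
  where "hom_coeffs a = map_poly (\<lambda>c. \<gamma> [:c:]) a"

lemma coeff_hom_coeffs: "coeff (hom_coeffs a) n = \<gamma> [:coeff a n:]"
  by (simp add: hom_coeffs_def coeff_map_poly)

lemma hom_coeffs_0 [simp]: "hom_coeffs 0 = 0"
  by (simp add: hom_coeffs_def)

lemma hom_coeffs_pCons: "hom_coeffs (pCons c a) = pCons (\<gamma> [:c:]) (hom_coeffs a)"
  by (rule poly_eqI) (simp add: coeff_hom_coeffs coeff_pCons split: nat.split)

lemma hom_pCons: "\<gamma> (pCons c a) = \<gamma> [:c:] + \<alpha> * \<gamma> a"
proof -
  have "\<gamma> (pCons c a) = \<gamma> ([:c:] + var_T * a)"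
    by simp
  then show ?thesis
    by (simp only: hom_add hom_mult)
qed

lemma poly_hom_coeffs: "poly (hom_coeffs a) \<alpha> = \<gamma> a"
proof (induction a)
  case (pCons c a)
  then show ?case
    by (simp only: hom_coeffs_pCons poly_pCons hom_pCons [of c a])
qed simp

lemma poly_hom_coeffs_frobenius: "poly (hom_coeffs a) (x ^ q ^ n) = poly (hom_coeffs a) x ^ q ^ n"
proof (induction a)
  case (pCons c a)
  then show ?case
    by (simp only: hom_coeffs_pCons poly_pCons frobenius_power_add power_mult_distrib
        hom_const_power)
qed simp

lemma degree_hom_coeffs: "degree (hom_coeffs a) = degree a"
  unfolding hom_coeffs_def
proof (rule degree_map_poly)
  fix c :: 'a assume "c \<noteq> 0"
  then show "\<gamma> [:c:] \<noteq> 0"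
    using injD [OF inj_hom_const, of c 0] by auto
qed

end

section \<open>Conjugates of the class of T\<close>

locale residue_at_prime = Fq_algebra q \<gamma>
  for q :: nat and \<gamma> :: "'a :: {finite, field} poly \<Rightarrow> 'k :: field" +
  fixes L :: "'a poly" and d :: nat
  assumes L_nonconstant: "d > 0"
    and degree_L: "degree L = d"
    and kernel: "\<gamma> a = 0 \<longleftrightarrow> L dvd a"
begin

lemma hom_L [simp]: "\<gamma> L = 0"
  by (simp add: kernel)

lemma card_range_hom_ge:
  assumes "finite (range \<gamma>)"
  shows "q ^ d \<le> card (range \<gamma>)"
proof -
  let ?W = "{xs :: 'a list. set xs \<subseteq> UNIV \<and> length xs = d}"
  have "inj_on (\<gamma> \<circ> Poly) ?W"
  proof (rule inj_onI)
    fix xs ys :: "'a list"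
    assume xs: "xs \<in> ?W" and ys: "ys \<in> ?W" and "(\<gamma> \<circ> Poly) xs = (\<gamma> \<circ> Poly) ys"
    then have "L dvd Poly xs - Poly ys"
      by (simp flip: kernel)
    moreover have "degree (Poly xs - Poly ys) < d"
      using xs ys L_nonconstant
      by (intro degree_lessI) (auto simp: nth_default_beyond)
    ultimately have "Poly xs = Poly ys"
      using dvd_imp_degree_le [of L "Poly xs - Poly ys"] degree_L by fastforce
    then have "nth_default 0 xs = nth_default 0 ys"
      by (metis coeff_Poly_eq)
    with xs ys show "xs = ys"
      by (auto intro!: nth_equalityI dest: fun_cong simp: nth_default_nth) (metis nth_default_nth)
  qed
  then have "card ?W \<le> card (range \<gamma>)"
    using assms by (intro card_inj_on_le [where f = "\<gamma> \<circ> Poly"]) auto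
  then show ?thesis
    by (subst (asm) card_lists_length_eq) (auto simp: q_eq)
qed

text \<open>
  A fixed point \<open>\<alpha>\<close> of the \<open>q^i\<close>-Frobenius would force all \<open>q ^ d\<close> elements of the residue field,
  which are polynomial expressions in \<open>\<alpha>\<close>, to be roots of \<open>X^(q^i) - X\<close>.
\<close>

lemma \<alpha>_frobenius_neq:
  assumes "0 < i" "i < d"
  shows "\<alpha> ^ q ^ i \<noteq> \<alpha>"
proof
  assume fixed: "\<alpha> ^ q ^ i = \<alpha>"
  have range: "range \<gamma> \<subseteq> {x. poly (monom 1 (q ^ i) - monom 1 1) x = 0}"
  proof safe
    fix a
    have "\<gamma> a ^ q ^ i = \<gamma> a"
      using poly_hom_coeffs_frobenius [of a \<alpha> i] by (simp add: fixed poly_hom_coeffs)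
    then show "poly (monom 1 (q ^ i) - monom 1 1) (\<gamma> a) = 0"
      by (simp add: poly_monom)
  qed
  have "1 < q ^ i"
    using assms q_gt_1 by (intro one_less_power)
  then have coeff: "coeff (monom 1 (q ^ i) - monom 1 1 :: 'k poly) (q ^ i) = 1"
    by simp
  then have nz: "monom 1 (q ^ i) - monom 1 1 \<noteq> (0 :: 'k poly)"
    by (metis coeff_0 zero_neq_one)
  have "degree (monom 1 (q ^ i) - monom 1 1 :: 'k poly) \<le> q ^ i"
    using \<open>1 < q ^ i\<close> by (intro degree_diff_le order.trans [OF degree_monom_le]) auto
  then have "card (range \<gamma>) \<le> q ^ i"
    using card_mono [OF poly_roots_finite [OF nz] range] card_poly_roots_bound [OF nz] by linarith
  moreover have "finite (range \<gamma>)"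
    using finite_subset [OF range poly_roots_finite [OF nz]] .
  moreover have "q ^ i < q ^ d"
    using assms q_gt_1 by simp
  ultimately show False
    using card_range_hom_ge by linarith
qed

lemma \<alpha>_frobenius_inj: "inj_on (\<lambda>i. \<alpha> ^ q ^ i) {..<d}"
proof (rule linorder_inj_onI)
  fix i j assume "i < j" "i \<in> {..<d}" "j \<in> {..<d}"
  show "\<alpha> ^ q ^ i \<noteq> \<alpha> ^ q ^ j"
  proof
    assume "\<alpha> ^ q ^ i = \<alpha> ^ q ^ j"
    then have "\<alpha> ^ q ^ i = (\<alpha> ^ q ^ (j - i)) ^ q ^ i"
      using \<open>i < j\<close> by (simp only: frobenius_power_comp) simp
    then show False
      using frobenius_power_inj \<alpha>_frobenius_neq [of "j - i"] \<open>i < j\<close> \<open>j \<in> {..<d}\<close> by force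
  qed
qed auto

lemma conjugate_root: "poly (hom_coeffs L) (\<alpha> ^ q ^ i) = 0"
  by (simp add: poly_hom_coeffs_frobenius poly_hom_coeffs)

lemma hom_coeffs_L_neq_0: "hom_coeffs L \<noteq> 0"
  using degree_hom_coeffs [of L] degree_L L_nonconstant by auto

lemma conjugates: "{x. poly (hom_coeffs L) x = 0} = (\<lambda>i. \<alpha> ^ q ^ i) ` {..<d}"
proof (rule sym, rule card_subset_eq)
  show "(\<lambda>i. \<alpha> ^ q ^ i) ` {..<d} \<subseteq> {x. poly (hom_coeffs L) x = 0}"
    using conjugate_root by auto
  moreover have "card ((\<lambda>i. \<alpha> ^ q ^ i) ` {..<d}) = d"
    using card_image [OF \<alpha>_frobenius_inj] by simp
  moreover show "finite {x. poly (hom_coeffs L) x = 0}"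
    by (rule poly_roots_finite [OF hom_coeffs_L_neq_0])
  ultimately show "card ((\<lambda>i. \<alpha> ^ q ^ i) ` {..<d}) = card {x. poly (hom_coeffs L) x = 0}"
    using card_poly_roots_bound [OF hom_coeffs_L_neq_0] degree_hom_coeffs [of L] degree_L
    by (metis card_mono le_antisym)
qed

text \<open>
  The \<open>d\<close> conjugates already exhaust the roots of \<open>L\<close>, so the next one repeats an earlier one; since
  the Frobenius is injective, it can only be \<open>\<alpha>\<close>.
\<close>

lemma \<alpha>_frobenius_d: "\<alpha> ^ q ^ d = \<alpha>"
proof -
  have "\<alpha> ^ q ^ d \<in> (\<lambda>i. \<alpha> ^ q ^ i) ` {..<d}"
    using conjugate_root [of d] by (simp flip: conjugates)
  then obtain i where i: "i < d" "\<alpha> ^ q ^ d = \<alpha> ^ q ^ i"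
    by auto
  then have "(\<alpha> ^ q ^ (d - i)) ^ q ^ i = \<alpha> ^ q ^ i"
    by (simp only: frobenius_power_comp) simp
  then have "\<alpha> ^ q ^ (d - i) = \<alpha>"
    by (rule frobenius_power_inj)
  moreover from this have "i = 0"
    using \<alpha>_frobenius_neq [of "d - i"] i by (cases i) auto
  ultimately show ?thesis
    by simp
qed

text \<open>
  The prime \<open>L\<close> is separable: it has \<open>d\<close> distinct roots. If \<open>\<alpha>\<close> were a double root, the quotient of
  \<open>L\<close> by \<open>X - \<alpha>\<close> would still vanish at all of them, although its degree is \<open>d - 1\<close>.
\<close>

lemma pderiv_hom_coeffs_L: "poly (pderiv (hom_coeffs L)) \<alpha> \<noteq> 0"
proof
  assume deriv: "poly (pderiv (hom_coeffs L)) \<alpha> = 0"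
  have "poly (hom_coeffs L) \<alpha> = 0"
    by (simp add: poly_hom_coeffs)
  then obtain h where h: "hom_coeffs L = [:-\<alpha>, 1:] * h"
    by (auto simp: poly_eq_0_iff_dvd dvd_def)
  then have "h \<noteq> 0"
    using hom_coeffs_L_neq_0 by auto
  have "poly h \<alpha> = 0"
    using deriv by (simp add: h pderiv_diff pderiv_smult pderiv_pCons)
  moreover have "poly h x = 0" if "poly (hom_coeffs L) x = 0" "x \<noteq> \<alpha>" for x
    using that unfolding h by simp
  ultimately have "{x. poly (hom_coeffs L) x = 0} \<subseteq> {x. poly h x = 0}"
    by blast
  then have "card ((\<lambda>i. \<alpha> ^ q ^ i) ` {..<d}) \<le> card {x. poly h x = 0}"
    unfolding conjugates by (rule card_mono [OF poly_roots_finite [OF \<open>h \<noteq> 0\<close>]])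
  then have "d \<le> card {x. poly h x = 0}"
    by (simp add: card_image [OF \<alpha>_frobenius_inj])
  also have "\<dots> \<le> degree h"
    by (rule card_poly_roots_bound [OF \<open>h \<noteq> 0\<close>])
  also have "degree h < degree (hom_coeffs L)"
    unfolding h using \<open>h \<noteq> 0\<close> by (subst degree_mult_eq) auto
  finally show False
    by (simp add: degree_hom_coeffs degree_L)
qed

end

section \<open>Twisted polynomials\<close>

lemma coeff_twisted_mult:
  fixes f g :: "'k :: field poly"
  assumes "q > 0"
  shows "coeff (twisted_mult q f g) n = (\<Sum>i\<le>n. coeff f i * coeff g (n - i) ^ q ^ i)"
proof -
  have inner: "(\<Sum>j\<le>degree g. coeff (monom (coeff f i * coeff g j ^ q ^ i) (i + j)) n) =
      (if i \<le> n then coeff f i * coeff g (n - i) ^ q ^ i else 0)" for i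
  proof (cases "i \<le> n")
    case True
    have "(\<Sum>j\<le>degree g. coeff (monom (coeff f i * coeff g j ^ q ^ i) (i + j)) n) =
        (\<Sum>j\<le>degree g. if j = n - i then coeff f i * coeff g j ^ q ^ i else 0)"
      using True by (intro sum.cong) auto
    also have "\<dots> = coeff f i * coeff g (n - i) ^ q ^ i"
      using assms by (simp add: coeff_eq_0)
    finally show ?thesis
      using True by simp
  qed auto
  have "coeff (twisted_mult q f g) n =
      (\<Sum>i\<le>degree f. if i \<le> n then coeff f i * coeff g (n - i) ^ q ^ i else 0)"
    by (simp add: twisted_mult_def coeff_sum inner del: coeff_monom)
  also have "\<dots> = (\<Sum>i\<in>{..degree f} \<inter> {..n}. coeff f i * coeff g (n - i) ^ q ^ i)"
    by (subst sum.inter_restrict) simp_all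
  also have "\<dots> = (\<Sum>i\<le>n. coeff f i * coeff g (n - i) ^ q ^ i)"
    by (intro sum.mono_neutral_left) (auto simp: coeff_eq_0)
  finally show ?thesis .
qed

text \<open>
  If the lowest term of \<open>f\<close> is \<open>c \<tau> ^ m\<close> with \<open>m < degree f\<close>, then as a function of \<open>x\<close> it is
  \<open>x^(q^m) * G(x)\<close>, where \<open>G\<close> is a nonconstant polynomial with constant term \<open>c\<close>. Its roots are
  nonzero elements of the kernel.
\<close>

lemma twisted_kernel_trivial_iff:
  fixes f :: "'k :: alg_closed_field poly"
  assumes "f \<noteq> 0" "q > 1"
  shows "(\<forall>x. twisted_apply q f x = 0 \<longrightarrow> x = 0) \<longleftrightarrow> (\<forall>i<degree f. coeff f i = 0)"
proof
  assume low: "\<forall>i<degree f. coeff f i = 0"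
  have "twisted_apply q f x = lead_coeff f * x ^ q ^ degree f" for x
  proof -
    have "twisted_apply q f x = (\<Sum>i\<in>{degree f}. coeff f i * x ^ q ^ i)"
      unfolding twisted_apply_def using low
      by (intro sum.mono_neutral_right) auto
    then show ?thesis
      by simp
  qed
  then show "\<forall>x. twisted_apply q f x = 0 \<longrightarrow> x = 0"
    using \<open>f \<noteq> 0\<close> by auto
next
  assume kernel: "\<forall>x. twisted_apply q f x = 0 \<longrightarrow> x = 0"
  show "\<forall>i<degree f. coeff f i = 0"
  proof (rule ccontr)
    assume "\<not> ?thesis"
    then have ex: "\<exists>i. i < degree f \<and> coeff f i \<noteq> 0"
      by blast
    define m where "m = (LEAST i. i < degree f \<and> coeff f i \<noteq> 0)"
    have m: "m < degree f" "coeff f m \<noteq> 0"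
      using LeastI_ex [OF ex] unfolding m_def by auto
    have below: "coeff f i = 0" if "i < m" for i
      using not_less_Least [of i "\<lambda>i. i < degree f \<and> coeff f i \<noteq> 0"] that m(1)
      unfolding m_def by auto
    define G where "G = (\<Sum>i\<in>{m..degree f}. monom (coeff f i) (q ^ i - q ^ m))"
    have split: "twisted_apply q f x = x ^ q ^ m * poly G x" for x
    proof -
      have "twisted_apply q f x = (\<Sum>i\<in>{m..degree f}. coeff f i * x ^ q ^ i)"
        unfolding twisted_apply_def using below
        by (intro sum.mono_neutral_right) auto
      also have "\<dots> = (\<Sum>i\<in>{m..degree f}. x ^ q ^ m * (coeff f i * x ^ (q ^ i - q ^ m)))"
      proof (intro sum.cong refl)
        fix i assume "i \<in> {m..degree f}"
        then have "q ^ m \<le> q ^ i"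
          using \<open>q > 1\<close> by (intro power_increasing) auto
        then have "x ^ q ^ i = x ^ q ^ m * x ^ (q ^ i - q ^ m)"
          by (simp flip: power_add)
        then show "coeff f i * x ^ q ^ i = x ^ q ^ m * (coeff f i * x ^ (q ^ i - q ^ m))"
          by simp
      qed
      finally show ?thesis
        by (simp add: G_def poly_sum poly_monom sum_distrib_left)
    qed
    have exponent: "q ^ i - q ^ m = q ^ j - q ^ m \<longleftrightarrow> i = j" if "m \<le> i" "m \<le> j" for i j
    proof -
      have "q ^ m \<le> q ^ i" "q ^ m \<le> q ^ j"
        using that \<open>q > 1\<close> by (auto intro!: power_increasing)
      then have "q ^ i - q ^ m = q ^ j - q ^ m \<longleftrightarrow> q ^ i = q ^ j"
        by linarith
      then show ?thesis
        using \<open>q > 1\<close> by (simp add: power_inject_exp)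
    qed
    have coeff_G: "coeff G (q ^ j - q ^ m) = coeff f j" if "m \<le> j" "j \<le> degree f" for j
    proof -
      have "coeff G (q ^ j - q ^ m) = (\<Sum>i\<in>{m..degree f}. if i = j then coeff f i else 0)"
        unfolding G_def coeff_sum
        by (intro sum.cong refl) (use that exponent in auto)
      with that show ?thesis
        by simp
    qed
    have "poly G 0 \<noteq> 0"
      using coeff_G [of m] m by (simp add: poly_0_coeff_0)
    have "q ^ m < q ^ degree f"
      using m \<open>q > 1\<close> by simp
    moreover have "coeff G (q ^ degree f - q ^ m) \<noteq> 0"
      using coeff_G [of "degree f"] m \<open>f \<noteq> 0\<close> by simp
    ultimately have "degree G > 0"
      using le_degree by fastforce
    then obtain x where "poly G x = 0"
      using alg_closed_imp_poly_has_root by blast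
    then have "x \<noteq> 0" "twisted_apply q f x = 0"
      using \<open>poly G 0 \<noteq> 0\<close> by (auto simp: split)
    with kernel show False
      by blast
  qed
qed

context Fq_algebra
begin

abbreviation tmult :: "'k poly \<Rightarrow> 'k poly \<Rightarrow> 'k poly"  (infixl "\<star>" 70)
  where "f \<star> g \<equiv> twisted_mult q f g"

lemmas coeff_tmult = coeff_twisted_mult [OF q_pos]

lemma tmult_add_right: "f \<star> (g + h) = f \<star> g + f \<star> h"
  by (rule poly_eqI) (simp add: coeff_tmult frobenius_power_add distrib_left sum.distrib)

lemma tmult_assoc: "f \<star> g \<star> h = f \<star> (g \<star> h)"
proof (rule poly_eqI)
  fix n
  let ?t = "\<lambda>i j. coeff f i * (coeff g j) ^ q ^ i * coeff h (n - i - j) ^ q ^ (i + j)"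
  have "coeff (f \<star> g \<star> h) n = (\<Sum>k\<le>n. \<Sum>i\<le>k. ?t i (k - i))"
    by (simp add: coeff_tmult sum_distrib_right)
  also have "\<dots> = (\<Sum>(i, j)\<in>{(i, j). i + j \<le> n}. ?t i j)"
    by (rule sum.triangle_reindex_eq [symmetric])
  also have "{(i, j). i + j \<le> n} = (SIGMA i:{..n}. {..n - i})"
    by auto
  also have "(\<Sum>(i, j)\<in>(SIGMA i:{..n}. {..n - i}). ?t i j) = (\<Sum>i\<le>n. \<Sum>j\<le>n - i. ?t i j)"
    by (rule sum.Sigma [symmetric]) auto
  also have "\<dots> = coeff (f \<star> (g \<star> h)) n"
    unfolding coeff_tmult
  proof (intro sum.cong refl)
    fix i
    show "(\<Sum>j\<le>n - i. ?t i j) =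
        coeff f i * (\<Sum>j\<le>n - i. coeff g j * coeff h (n - i - j) ^ q ^ j) ^ q ^ i"
      unfolding frobenius_power_sum sum_distrib_left
    proof (intro sum.cong refl)
      fix j
      have "(coeff g j * coeff h (n - i - j) ^ q ^ j) ^ q ^ i =
          coeff g j ^ q ^ i * coeff h (n - i - j) ^ q ^ (i + j)"
        unfolding power_mult_distrib frobenius_power_comp by (simp add: add.commute)
      then show "?t i j = coeff f i * (coeff g j * coeff h (n - i - j) ^ q ^ j) ^ q ^ i"
        by simp
    qed
  qed
  finally show "coeff (f \<star> g \<star> h) n = coeff (f \<star> (g \<star> h)) n" .
qed

lemma coeff_tmult_quadratic:
  "coeff (f \<star> [:a, b, c:]) n =
     coeff f n * a ^ q ^ n +
     (if 1 \<le> n then coeff f (n - 1) * b ^ q ^ (n - 1) else 0) +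
     (if 2 \<le> n then coeff f (n - 2) * c ^ q ^ (n - 2) else 0)"
proof -
  let ?t = "\<lambda>i. coeff f i * coeff [:a, b, c:] (n - i) ^ q ^ i"
  consider "n = 0" | "n = 1" | m where "n = Suc (Suc m)"
    by (cases n; cases "n - 1") auto
  then show ?thesis
  proof cases
    case (3 m)
    have "?t i = 0" if "i < m" for i
    proof -
      have "n - i = Suc (Suc (Suc (m - Suc i)))"
        using that 3 by simp
      then show ?thesis
        by simp
    qed
    then have "sum ?t {..<m} = 0"
      by (intro sum.neutral) auto
    moreover have "sum ?t {..n} = sum ?t {..<m} + ?t m + ?t (Suc m) + ?t (Suc (Suc m))"
      unfolding 3 by (simp only: sum.lessThan_Suc flip: lessThan_Suc_atMost)
    ultimately show ?thesis
      using 3 by (simp add: coeff_tmult numeral_2_eq_2)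
  qed (simp_all add: coeff_tmult)
qed

lemma coeff_tmult_const: "coeff (f \<star> [:a:]) n = coeff f n * a ^ q ^ n"
  using coeff_tmult_quadratic [of f a 0 0 n] by simp

lemma coeff_tmult_linear:
  "coeff (f \<star> [:a, b:]) n =
     coeff f n * a ^ q ^ n + (if 1 \<le> n then coeff f (n - 1) * b ^ q ^ (n - 1) else 0)"
  using coeff_tmult_quadratic [of f a b 0 n] by simp

end

section \<open>The lowest term of the action of L\<close>

locale drinfeld_at_prime = residue_at_prime q \<gamma> L d
  for q :: nat and \<gamma> :: "'a :: {finite, field} poly \<Rightarrow> 'k :: field" and L d +
  fixes \<phi> :: "'a poly \<Rightarrow> 'k poly" and u :: 'k
  assumes u_neq_0: "u \<noteq> 0"
    and \<phi>_const: "\<phi> [:c:] = [:\<gamma> [:c:]:]"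
    and \<phi>_add: "\<phi> (a + b) = \<phi> a + \<phi> b"
    and \<phi>_mult: "\<phi> (a * b) = \<phi> a \<star> \<phi> b"
    and \<phi>_T: "\<phi> var_T = [:\<alpha>, u + \<alpha>, u:]"
begin

lemma \<phi>_0 [simp]: "\<phi> 0 = 0"
  using \<phi>_const [of 0] by simp

lemma \<phi>_pCons: "\<phi> (pCons c a) = [:\<gamma> [:c:]:] + \<phi> a \<star> \<phi> var_T"
proof -
  have "\<phi> (pCons c a) = \<phi> ([:c:] + a * var_T)"
    by simp
  then show ?thesis
    by (simp only: \<phi>_add \<phi>_mult \<phi>_const)
qed

lemma \<phi>_leading:
  assumes "a \<noteq> 0"
  shows "(\<forall>n > 2 * degree a. coeff (\<phi> a) n = 0) \<and> coeff (\<phi> a) (2 * degree a) \<noteq> 0"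
  using assms
proof (induction a)
  case (pCons c a)
  show ?case
  proof (cases "a = 0")
    case True
    with pCons have "\<gamma> [:c:] \<noteq> 0"
      using injD [OF inj_hom_const, of c 0] by auto
    with True show ?thesis
      by (auto simp: \<phi>_const coeff_pCons split: nat.split)
  next
    case False
    have top: "coeff (\<phi> (pCons c a)) n = coeff (\<phi> a) (n - 2) * u ^ q ^ (n - 2)"
      if "n \<ge> 2 * degree a + 2" for n
      using pCons.IH [OF False] that
      unfolding \<phi>_pCons [of c a] \<phi>_T coeff_add coeff_tmult_quadratic
      by (auto simp: coeff_pCons split: nat.split)
    show ?thesis
      using pCons.IH [OF False] u_neq_0 False by (auto simp: top)
  qed
qed simp

text \<open>
  A \<open>\<Lambda>\<close> which is an eigenvector of \<open>\<phi>\<^sub>T\<close> up to the error \<open>h \<tau> ^ d\<close> is an eigenvector of every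
  \<open>\<phi>\<^sub>a\<close> up to an error proportional to \<open>h\<close>. The factor satisfies the Leibniz rule, because \<open>\<tau> ^ d\<close>
  commutes with \<open>\<alpha>\<close>, and it is \<open>1\<close> for \<open>a = T\<close> and \<open>0\<close> for constants: it is the derivative of \<open>a\<close>.
\<close>

lemma coeff_eigen_mod_degree:
  assumes eigen: "\<And>n. n \<le> d \<Longrightarrow>
      coeff (\<Lambda> \<star> \<phi> var_T) n = \<alpha> * coeff \<Lambda> n + (if n = d then h else 0)"
    and "n \<le> d"
  shows "coeff (\<Lambda> \<star> \<phi> a) n =
    \<gamma> a * coeff \<Lambda> n + (if n = d then poly (pderiv (hom_coeffs a)) \<alpha> * h else 0)"
  using \<open>n \<le> d\<close>
proof (induction a arbitrary: n)
  case 0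
  show ?case
    by (simp add: coeff_tmult q_pos)
next
  case (pCons c a)
  let ?D = "poly (pderiv (hom_coeffs a)) \<alpha>"
  have "coeff (\<Lambda> \<star> \<phi> a \<star> \<phi> var_T) n =
      \<gamma> a * coeff (\<Lambda> \<star> \<phi> var_T) n + (if n = d then ?D * h * \<alpha> ^ q ^ d else 0)"
  proof -
    have "coeff (\<Lambda> \<star> \<phi> a) (n - 1) = \<gamma> a * coeff \<Lambda> (n - 1)" if "1 \<le> n"
      using pCons.IH [of "n - 1"] pCons.prems that by auto
    moreover have "coeff (\<Lambda> \<star> \<phi> a) (n - 2) = \<gamma> a * coeff \<Lambda> (n - 2)" if "2 \<le> n"
      using pCons.IH [of "n - 2"] pCons.prems that by auto
    ultimately show ?thesis
      unfolding \<phi>_T coeff_tmult_quadratic using pCons.IH [OF pCons.prems]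
      by (auto simp: algebra_simps)
  qed
  moreover have "\<Lambda> \<star> \<phi> (pCons c a) = \<Lambda> \<star> [:\<gamma> [:c:]:] + \<Lambda> \<star> \<phi> a \<star> \<phi> var_T"
    by (simp only: \<phi>_pCons [of c a] tmult_add_right tmult_assoc)
  moreover have "poly (pderiv (hom_coeffs (pCons c a))) \<alpha> = \<gamma> a + \<alpha> * ?D"
    by (simp only: hom_coeffs_pCons pderiv_pCons poly_add poly_pCons poly_hom_coeffs add_0_left)
  ultimately show ?case
    unfolding hom_pCons [of c a]
    by (simp add: coeff_tmult_const hom_const_power eigen [OF pCons.prems] \<alpha>_frobenius_d
        algebra_simps del: hom_add)
qed

text \<open>
  For \<open>a = L\<close> the eigenvalue is \<open>0\<close>, and \<open>\<Lambda>\<close>, having constant term \<open>1\<close>, does not change the lowest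
  term of what it multiplies.
\<close>

lemma
  assumes eigen: "\<And>n. n \<le> d \<Longrightarrow>
      coeff (\<Lambda> \<star> \<phi> var_T) n = \<alpha> * coeff \<Lambda> n + (if n = d then h else 0)"
    and unit: "coeff \<Lambda> 0 = 1"
  shows \<phi>_L_below: "n < d \<Longrightarrow> coeff (\<phi> L) n = 0"
    and \<phi>_L_hasse: "coeff (\<phi> L) d = poly (pderiv (hom_coeffs L)) \<alpha> * h"
proof -
  have step: "coeff (\<phi> L) n = coeff (\<Lambda> \<star> \<phi> L) n" if "\<And>m. m < n \<Longrightarrow> coeff (\<phi> L) m = 0" for n
  proof -
    have "coeff (\<Lambda> \<star> \<phi> L) n = (\<Sum>i\<in>{0}. coeff \<Lambda> i * coeff (\<phi> L) (n - i) ^ q ^ i)"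
      unfolding coeff_tmult using that by (intro sum.mono_neutral_right) auto
    then show ?thesis
      by (simp add: unit)
  qed
  note \<Lambda>_L = coeff_eigen_mod_degree [OF eigen, where a = L]
  show below: "n < d \<Longrightarrow> coeff (\<phi> L) n = 0" for n
  proof (induction n rule: less_induct)
    case (less n)
    then have "coeff (\<phi> L) n = coeff (\<Lambda> \<star> \<phi> L) n"
      by (intro step) auto
    with less.prems show ?case
      by (simp add: \<Lambda>_L)
  qed
  show "coeff (\<phi> L) d = poly (pderiv (hom_coeffs L)) \<alpha> * h"
    using step [OF below, of d] by (simp add: \<Lambda>_L)
qed

text \<open>
  Compare the coefficients of \<open>\<tau> ^ m\<close> on the two sides of \<open>\<phi>\<^sub>L \<star> \<phi>\<^sub>T = \<phi>\<^sub>T \<star> \<phi>\<^sub>L\<close>.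
\<close>

lemma \<phi>_L_lowest:
  assumes "coeff (\<phi> L) m \<noteq> 0" and below: "\<And>i. i < m \<Longrightarrow> coeff (\<phi> L) i = 0"
  shows "\<alpha> ^ q ^ m = \<alpha>"
proof -
  have "coeff (\<phi> L \<star> \<phi> var_T) m = coeff (\<phi> L) m * \<alpha> ^ q ^ m"
    unfolding \<phi>_T coeff_tmult_quadratic using below by auto
  moreover have "coeff (\<phi> var_T \<star> \<phi> L) m =
      (\<Sum>i\<in>{0}. coeff (\<phi> var_T) i * coeff (\<phi> L) (m - i) ^ q ^ i)"
    unfolding coeff_tmult using below by (intro sum.mono_neutral_right) auto
  moreover have "\<phi> L \<star> \<phi> var_T = \<phi> var_T \<star> \<phi> L"
    by (simp only: mult.commute flip: \<phi>_mult)
  ultimately show ?thesis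
    using assms(1) by (simp add: \<phi>_T)
qed

text \<open>
  A lowest exponent \<open>n\<close> strictly between \<open>d\<close> and \<open>2 d\<close> is excluded, because \<open>\<alpha>\<close> would be fixed by
  the \<open>q^n\<close>-Frobenius and hence by the \<open>q^(n-d)\<close>-Frobenius.
\<close>

lemma \<phi>_L_purely_inseparable_iff_hasse:
  assumes below: "\<And>n. n < d \<Longrightarrow> coeff (\<phi> L) n = 0"
  shows "(\<forall>n<2 * d. coeff (\<phi> L) n = 0) \<longleftrightarrow> coeff (\<phi> L) d = 0"
proof
  assume hasse: "coeff (\<phi> L) d = 0"
  show "\<forall>n<2 * d. coeff (\<phi> L) n = 0"
  proof (intro allI)
    fix n
    show "n < 2 * d \<longrightarrow> coeff (\<phi> L) n = 0"
    proof (induction n rule: less_induct)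
      case (less n)
      show ?case
      proof (intro impI, rule ccontr)
        assume n: "n < 2 * d" "coeff (\<phi> L) n \<noteq> 0"
        then have "d < n"
          using below [of n] hasse by (cases n d rule: linorder_cases) auto
        have "\<alpha> ^ q ^ (n - d) = (\<alpha> ^ q ^ d) ^ q ^ (n - d)"
          by (simp only: \<alpha>_frobenius_d)
        also have "\<dots> = \<alpha> ^ q ^ n"
          unfolding frobenius_power_comp using \<open>d < n\<close> by simp
        also have "\<dots> = \<alpha>"
          using less n by (intro \<phi>_L_lowest) auto
        finally show False
          using \<alpha>_frobenius_neq [of "n - d"] n \<open>d < n\<close> by simp
      qed
    qed
  qed
qed (use L_nonconstant in auto)

text \<open>
  Both sides are \<open>(\<tau> + 1) \<star> (u\<tau> + \<alpha>) \<star> (\<tau> + 1)\<close>: the twisted polynomial \<open>\<tau> + 1\<close> is an isogeny to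
  the module whose logarithm has the \<open>p\<^sub>i\<close> as numerators.
\<close>

lemma tmult_T_isogeny: "[:1, 1:] \<star> [:\<alpha>, u + \<alpha>, u:] = [:\<alpha>, u + \<alpha> ^ q, u ^ q:] \<star> [:1, 1:]"
proof -
  have "[:\<alpha>, u + \<alpha>, u:] = [:\<alpha>, u:] \<star> [:1, 1:]"
    by (rule poly_eqI)
      (auto simp: coeff_tmult_linear coeff_pCons numeral_2_eq_2 split: nat.split)
  moreover have "[:\<alpha>, u + \<alpha> ^ q, u ^ q:] = [:1, 1:] \<star> [:\<alpha>, u:]"
    by (rule poly_eqI)
      (auto simp: coeff_tmult_linear coeff_pCons numeral_2_eq_2 split: nat.split)
  ultimately show ?thesis
    by (simp only: tmult_assoc)
qed

text \<open>
  The construction of \<open>\<Lambda>\<close>. Below, \<open>l i\<close> is the coefficient of \<open>\<tau> ^ i\<close> in the logarithm of the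
  isogenous module, with denominator \<open>C i\<close>; the coefficient for \<open>i = d\<close>, where the recursion would
  divide by \<open>c d = 0\<close>, is replaced by \<open>0\<close>.
\<close>

lemma \<phi>_L_purely_inseparable_iff:
  fixes s :: 'k and P c :: "nat \<Rightarrow> 'k"
  assumes \<alpha>_neq_0: "\<alpha> \<noteq> 0"
    and u_eq: "u = - (s * \<alpha> ^ q)"
    and c_eq: "\<And>i. c i = (\<alpha> ^ q ^ i - \<alpha>) / \<alpha> ^ q ^ i"
    and P_0: "P 0 = 1"
    and P_Suc: "\<And>i. P (Suc i) = (s ^ q ^ i - 1) * P i + c i * s ^ q ^ i * (case i of 0 \<Rightarrow> 0 | Suc j \<Rightarrow> P j)"
  shows "(\<forall>n<2 * d. coeff (\<phi> L) n = 0) \<longleftrightarrow> P d = 0"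
proof -
  define C where "C i = (\<Prod>j\<in>{1..i}. c j)" for i
  define l where "l i = P i / C i" for i
  define h where "h = - (\<alpha> ^ q ^ d * P d / C (d - 1))"
  define \<Lambda>\<^sub>0 where "\<Lambda>\<^sub>0 = (\<Sum>i<d. monom (l i) i)"
  define \<Lambda> where "\<Lambda> = \<Lambda>\<^sub>0 \<star> [:1, 1:]"
  have c_neq_0: "c i \<noteq> 0" if "0 < i" "i < d" for i
    using \<alpha>_frobenius_neq [OF that] \<alpha>_neq_0 by (simp add: c_eq)
  have C_neq_0: "C i \<noteq> 0" if "i < d" for i
    using that c_neq_0 by (auto simp: C_def)
  have C_Suc: "C (Suc i) = C i * c (Suc i)" for i
    by (simp add: C_def)
  have coeff_\<Lambda>\<^sub>0: "coeff \<Lambda>\<^sub>0 n = (if n < d then l n else 0)" for n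
    by (simp add: \<Lambda>\<^sub>0_def coeff_sum)
  \<comment> \<open>the part of the coefficient of \<open>\<tau> ^ (m+1)\<close> in \<open>\<Lambda>\<^sub>0 \<star> \<psi>\<^sub>T\<close> that comes from the terms of lower degree\<close>
  have shifted: "l m * (u + \<alpha> ^ q) ^ q ^ m +
      (if 1 \<le> m then l (m - 1) * (u ^ q) ^ q ^ (m - 1) else 0) =
      - (\<alpha> ^ q ^ Suc m * P (Suc m) / C m)" if "m < d" for m
  proof -
    have pow_q: "(x ^ q) ^ q ^ n = x ^ q ^ Suc n" for x :: 'k and n
      by (simp only: power_Suc power_mult)
    have u_pow: "u ^ q ^ n = - (s ^ q ^ n * \<alpha> ^ q ^ Suc n)" for n
      unfolding u_eq frobenius_power_uminus power_mult_distrib pow_q ..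
    have 1: "(u + \<alpha> ^ q) ^ q ^ m = - ((s ^ q ^ m - 1) * \<alpha> ^ q ^ Suc m)"
      unfolding frobenius_power_add u_pow pow_q by (simp add: algebra_simps)
    show ?thesis
    proof (cases m)
      case 0
      then show ?thesis
        using 1 P_Suc [of 0] by (simp add: l_def P_0 C_def)
    next
      case (Suc k)
      have 2: "l (m - 1) = P k * c m / C m"
        using C_Suc [of k] c_neq_0 [of m] \<open>m < d\<close> Suc C_neq_0 [of k] by (simp add: l_def)
      have 3: "(u ^ q) ^ q ^ (m - 1) = - (s ^ q ^ m * \<alpha> ^ q ^ Suc m)"
        unfolding pow_q u_pow [symmetric] using Suc by simp
      have 4: "P (Suc m) = (s ^ q ^ m - 1) * P m + c m * s ^ q ^ m * P k"
        using P_Suc [of m] Suc by simp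
      have "1 \<le> m"
        using Suc by simp
      then show ?thesis
        unfolding 1 2 3 4 l_def [of m]
        by (simp add: add_divide_distrib diff_divide_distrib algebra_simps del: power_Suc)
    qed
  qed
  \<comment> \<open>\<open>c n\<close> is chosen so that \<open>\<alpha>^(q^n) (1 - c n) = \<alpha>\<close>, which makes the error vanish for \<open>n < d\<close>\<close>
  have eigen\<^sub>0: "coeff (\<Lambda>\<^sub>0 \<star> [:\<alpha>, u + \<alpha> ^ q, u ^ q:]) n =
      \<alpha> * coeff \<Lambda>\<^sub>0 n + (if n = d then h else 0)" if "n \<le> d" for n
  proof (cases n)
    case 0
    then show ?thesis
      using L_nonconstant by (simp add: coeff_tmult_quadratic)
  next
    case (Suc m)
    have expand: "coeff (\<Lambda>\<^sub>0 \<star> [:\<alpha>, u + \<alpha> ^ q, u ^ q:]) n =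
        coeff \<Lambda>\<^sub>0 n * \<alpha> ^ q ^ n - \<alpha> ^ q ^ n * P n / C m"
      using shifted [of m] that Suc unfolding coeff_tmult_quadratic coeff_\<Lambda>\<^sub>0
      by (auto simp: numeral_2_eq_2 simp del: power_Suc)
    show ?thesis
    proof (cases "n = d")
      case True
      with Suc show ?thesis
        unfolding expand by (simp add: coeff_\<Lambda>\<^sub>0 h_def)
    next
      case False
      with that have "n < d"
        by simp
      then have "\<alpha> ^ q ^ n * P n / C m = (\<alpha> ^ q ^ n * c n) * l n"
        using Suc C_Suc [of m] c_neq_0 [of n] by (simp add: l_def)
      also have "\<alpha> ^ q ^ n * c n = \<alpha> ^ q ^ n - \<alpha>"
        using \<alpha>_neq_0 by (simp add: c_eq)
      finally show ?thesis
        unfolding expand using \<open>n < d\<close> by (simp add: coeff_\<Lambda>\<^sub>0 algebra_simps)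
    qed
  qed
  \<comment> \<open>transport along the isogeny; multiplying by \<open>\<tau> + 1\<close> leaves the error term in degree \<open>d\<close> unchanged\<close>
  have "\<Lambda> \<star> \<phi> var_T = \<Lambda>\<^sub>0 \<star> [:\<alpha>, u + \<alpha> ^ q, u ^ q:] \<star> [:1, 1:]"
    by (simp only: \<Lambda>_def \<phi>_T tmult_assoc tmult_T_isogeny)
  then have eigen: "coeff (\<Lambda> \<star> \<phi> var_T) n = \<alpha> * coeff \<Lambda> n + (if n = d then h else 0)"
    if "n \<le> d" for n
    using that eigen\<^sub>0 [of n] eigen\<^sub>0 [of "n - 1"] unfolding \<Lambda>_def
    by (auto simp: coeff_tmult_linear algebra_simps)
  have unit: "coeff \<Lambda> 0 = 1"
    using L_nonconstant by (simp add: \<Lambda>_def coeff_tmult_linear coeff_\<Lambda>\<^sub>0 l_def C_def P_0)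
  have "h = 0 \<longleftrightarrow> P d = 0"
    using \<alpha>_neq_0 C_neq_0 [of "d - 1"] L_nonconstant by (simp add: h_def)
  then show ?thesis
    using \<phi>_L_purely_inseparable_iff_hasse [OF \<phi>_L_below [OF eigen unit]]
      \<phi>_L_hasse [OF eigen unit] pderiv_hom_coeffs_L by simp
qed

end

section \<open>Reduction of the polynomials modulo L\<close>

context residue_at_prime
begin

text \<open>
  The relational form of \<open>reduce\<close>: it asserts in addition that a representation with denominator
  prime to \<open>L\<close> exists, so that it is closed under the ring operations without side conditions.
\<close>

definition reducible_to :: "'a poly fract \<Rightarrow> 'k \<Rightarrow> bool"
  where "reducible_to x y \<longleftrightarrow> (\<exists>a b. x = Fract a b \<and> \<gamma> b \<noteq> 0 \<and> y = \<gamma> a / \<gamma> b)"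

lemma reducible_to_unique:
  assumes "reducible_to x y" "reducible_to x y'"
  shows "y = y'"
proof -
  from assms obtain a b a' b' where
    ab: "x = Fract a b" "\<gamma> b \<noteq> 0" "y = \<gamma> a / \<gamma> b" and
    ab': "x = Fract a' b'" "\<gamma> b' \<noteq> 0" "y' = \<gamma> a' / \<gamma> b'"
    unfolding reducible_to_def by blast
  then have "b \<noteq> 0" "b' \<noteq> 0"
    by auto
  with ab ab' have "a * b' = a' * b"
    by (simp add: eq_fract)
  then have "\<gamma> a * \<gamma> b' = \<gamma> a' * \<gamma> b"
    by (simp flip: hom_mult)
  with ab ab' show ?thesis
    by (simp add: frac_eq_eq)
qed

lemma reduce_eqI: "reducible_to x y \<Longrightarrow> reduce \<gamma> x = y"
  unfolding reduce_def reducible_to_def [symmetric]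
  by (blast intro: the_equality reducible_to_unique)

lemma reducible_to_Fract: "\<gamma> b \<noteq> 0 \<Longrightarrow> reducible_to (Fract a b) (\<gamma> a / \<gamma> b)"
  unfolding reducible_to_def by blast

lemma reducible_to_0: "reducible_to 0 0"
  using reducible_to_Fract [of 1 0] by (simp add: Zero_fract_def)

lemma reducible_to_1: "reducible_to 1 1"
  using reducible_to_Fract [of 1 1] by (simp add: One_fract_def)

lemma reducible_to_diff:
  assumes "reducible_to x y" "reducible_to x' y'"
  shows "reducible_to (x - x') (y - y')"
proof -
  from assms obtain a b a' b' where
    ab: "x = Fract a b" "\<gamma> b \<noteq> 0" "y = \<gamma> a / \<gamma> b" and
    ab': "x' = Fract a' b'" "\<gamma> b' \<noteq> 0" "y' = \<gamma> a' / \<gamma> b'"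
    unfolding reducible_to_def by blast
  then have "b \<noteq> 0" "b' \<noteq> 0"
    by auto
  with ab ab' have "x - x' = Fract (a * b' - a' * b) (b * b')"
    by simp
  moreover have "y - y' = \<gamma> (a * b' - a' * b) / \<gamma> (b * b')"
    using ab ab' by (simp add: diff_frac_eq)
  moreover have "\<gamma> (b * b') \<noteq> 0"
    using ab ab' by simp
  ultimately show ?thesis
    by (metis reducible_to_Fract)
qed

lemma reducible_to_add:
  assumes "reducible_to x y" "reducible_to x' y'"
  shows "reducible_to (x + x') (y + y')"
  using reducible_to_diff [OF assms(1) reducible_to_diff [OF reducible_to_0 assms(2)]] by simp

lemma reducible_to_mult:
  assumes "reducible_to x y" "reducible_to x' y'"
  shows "reducible_to (x * x') (y * y')"
proof -
  from assms obtain a b a' b' where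
    "x = Fract a b" "\<gamma> b \<noteq> 0" "y = \<gamma> a / \<gamma> b" and
    "x' = Fract a' b'" "\<gamma> b' \<noteq> 0" "y' = \<gamma> a' / \<gamma> b'"
    unfolding reducible_to_def by blast
  then show ?thesis
    using reducible_to_Fract [of "b * b'" "a * a'"] by simp
qed

definition poly_reducible_to :: "'a poly fract poly \<Rightarrow> 'k poly \<Rightarrow> bool"
  where "poly_reducible_to p r \<longleftrightarrow> (\<forall>n. reducible_to (coeff p n) (coeff r n))"

lemma map_poly_reduce: "poly_reducible_to p r \<Longrightarrow> map_poly (reduce \<gamma>) p = r"
  by (rule poly_eqI)
    (simp add: coeff_map_poly reduce_eqI reducible_to_0 poly_reducible_to_def)

lemma poly_reducible_to_0: "poly_reducible_to 0 0"
  by (simp add: poly_reducible_to_def reducible_to_0)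

lemma poly_reducible_to_1: "poly_reducible_to 1 1"
  by (simp add: poly_reducible_to_def coeff_1 reducible_to_0 reducible_to_1)

lemma poly_reducible_to_add:
  "poly_reducible_to p r \<Longrightarrow> poly_reducible_to p' r' \<Longrightarrow> poly_reducible_to (p + p') (r + r')"
  by (simp add: poly_reducible_to_def reducible_to_add)

lemma poly_reducible_to_diff:
  "poly_reducible_to p r \<Longrightarrow> poly_reducible_to p' r' \<Longrightarrow> poly_reducible_to (p - p') (r - r')"
  by (simp add: poly_reducible_to_def reducible_to_diff)

lemma poly_reducible_to_monom_mult:
  "reducible_to x y \<Longrightarrow> poly_reducible_to p r \<Longrightarrow>
     poly_reducible_to (monom x n * p) (monom y n * r)"
  by (simp add: poly_reducible_to_def coeff_monom_mult reducible_to_0 reducible_to_mult)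

text \<open>
  The reduction of \<open>(T^(q^i-1) - 1) / T^(q^i-1)\<close>, expanded by \<open>\<alpha>\<close> so that the denominator
  \<open>\<alpha>^(q^i) - \<alpha>\<close> of the logarithm becomes visible.
\<close>

definition p_step :: "nat \<Rightarrow> 'k"
  where "p_step i = (\<alpha> ^ q ^ i - \<alpha>) / \<alpha> ^ q ^ i"

lemma reducible_to_p_step:
  assumes "\<alpha> \<noteq> 0"
  shows "reducible_to ((T_fract ^ (q ^ i - 1) - 1) / T_fract ^ (q ^ i - 1)) (p_step i)"
proof -
  define k where "k = q ^ i - 1"
  have k: "q ^ i = Suc k"
    using q_pos by (simp add: k_def)
  have T_pow: "T_fract ^ n = Fract (var_T ^ n) (1 :: 'a poly)" for n
    by (induction n) (simp_all add: T_fract_def One_fract_def)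
  have "var_T ^ k \<noteq> (0 :: 'a poly)"
    by simp
  then have "(T_fract ^ k - 1) / T_fract ^ k = Fract (var_T ^ k - 1) (var_T ^ k :: 'a poly)"
    by (simp add: T_pow One_fract_def)
  moreover have "p_step i = \<gamma> (var_T ^ k - 1) / \<gamma> (var_T ^ k)"
    using assms by (simp add: p_step_def k field_simps)
  ultimately show ?thesis
    using reducible_to_Fract [of "var_T ^ k" "var_T ^ k - 1"] assms by (simp add: k_def)
qed

fun p_reduced :: "nat \<Rightarrow> 'k poly" where
  "p_reduced 0 = 1"
| "p_reduced (Suc i) =
     (monom 1 (q ^ i) - 1) * p_reduced i +
     monom (p_step i) (q ^ i) * (case i of 0 \<Rightarrow> 0 | Suc j \<Rightarrow> p_reduced j)"

text \<open>
  The recursion reaches two steps back, so the induction carries the claim for the previous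
  polynomial along, with the value \<open>0\<close> before the first one.
\<close>

lemma map_poly_reduce_p_poly:
  assumes "\<alpha> \<noteq> 0"
  shows "map_poly (reduce \<gamma>) (p_poly i) = p_reduced i"
proof (rule map_poly_reduce)
  have "poly_reducible_to (p_poly i) (p_reduced i) \<and>
      poly_reducible_to (case i of 0 \<Rightarrow> 0 | Suc j \<Rightarrow> p_poly j) (case i of 0 \<Rightarrow> 0 | Suc j \<Rightarrow> p_reduced j)"
  proof (induction i)
    case (Suc i)
    then have "poly_reducible_to ((monom 1 (q ^ i) - 1) * p_poly i) ((monom 1 (q ^ i) - 1) * p_reduced i)"
      unfolding left_diff_distrib mult_1_left
      by (intro poly_reducible_to_diff poly_reducible_to_monom_mult reducible_to_1) simp_all
    moreover note poly_reducible_to_monom_mult [OF reducible_to_p_step [OF assms, of i] conjunct2 [OF Suc], of "q ^ i"]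
    ultimately show ?case
      using Suc by (auto simp: q_eq [symmetric] intro!: poly_reducible_to_add)
  qed (simp add: poly_reducible_to_0 poly_reducible_to_1)
  then show "poly_reducible_to (p_poly i) (p_reduced i)" ..
qed

end

section \<open>Supersingularity\<close>

theorem corollary20:
  fixes L :: "'a :: {finite, field} poly"
    and \<gamma> :: "'a poly \<Rightarrow> 'k :: alg_closed_field"
    and \<phi> :: "'a poly \<Rightarrow> 'k poly"
    and u :: 'k
    and d :: nat
  assumes "irreducible L" and "lead_coeff L = 1" and "L \<noteq> var_T"
    and "degree L = d" and "d \<ge> 1"
    and "residue_field_closure L \<gamma>"
    and "u \<noteq> 0"
    and "drinfeld_module \<gamma> \<phi>"
    and "\<phi> var_T = [:\<gamma> var_T, u + \<gamma> var_T, u:]"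
  shows "supersingular \<phi> L \<longleftrightarrow>
    poly (map_poly (reduce \<gamma>) (p_poly d)) (- u / \<gamma> var_T ^ CARD('a)) = 0"
proof -
  have kernel: "\<gamma> a = 0 \<longleftrightarrow> L dvd a" for a
    using assms(6) by (simp add: residue_field_closure_def)
  have hom: "\<gamma> 1 = 1" "\<gamma> (a + b) = \<gamma> a + \<gamma> b" "\<gamma> (a * b) = \<gamma> a * \<gamma> b" for a b
    using assms(6) unfolding residue_field_closure_def by blast+
  have \<phi>: "\<phi> [:c:] = [:\<gamma> [:c:]:]" "\<phi> (a + b) = \<phi> a + \<phi> b"
      "\<phi> (a * b) = twisted_mult CARD('a) (\<phi> a) (\<phi> b)" for a b c
    using assms(8) unfolding drinfeld_module_def by blast+
  interpret Fq_algebra "CARD('a)" \<gamma>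
    by (rule Fq_algebra.intro [OF refl hom])
  interpret residue_at_prime "CARD('a)" \<gamma> L d
    by unfold_locales (use assms(4,5) kernel in auto)
  interpret drinfeld_at_prime "CARD('a)" \<gamma> L d \<phi> u
    by unfold_locales (fact assms(7) \<phi> assms(9))+
  define s where "s = - u / \<gamma> var_T ^ CARD('a)"
  have \<alpha>_neq_0: "\<gamma> var_T \<noteq> 0"
  proof
    assume "\<gamma> var_T = 0"
    then obtain r where r: "var_T = L * r"
      by (auto simp: kernel dvd_def)
    then have "L \<noteq> 0" "r \<noteq> 0"
      by auto
    then have "degree L + degree r = 1"
      using arg_cong [OF r, of degree] by (simp add: degree_mult_eq)
    with assms(4,5) have "degree r = 0"
      by simp
    then obtain e where e: "r = [:e:]"
      by (rule degree_eq_zeroE)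
    have "lead_coeff var_T = lead_coeff L * lead_coeff r"
      by (simp only: r lead_coeff_mult)
    with e assms(2) have "e = 1"
      by simp
    with r e assms(3) show False
      by simp
  qed
  then have u_eq: "u = - (s * \<gamma> var_T ^ CARD('a))"
    by (simp add: s_def)
  have degree: "degree (\<phi> L) = 2 * d" and "\<phi> L \<noteq> 0"
  proof -
    have "L \<noteq> 0"
      using assms(1) by auto
    then have top: "coeff (\<phi> L) n = 0" "coeff (\<phi> L) (2 * d) \<noteq> 0" if "n > 2 * d" for n
      using \<phi>_leading [of L] assms(4) that by auto
    then show "degree (\<phi> L) = 2 * d"
      by (intro antisym degree_le le_degree) auto
    show "\<phi> L \<noteq> 0"
      using top(2) [of "Suc (2 * d)"] by auto
  qed
  have "supersingular \<phi> L \<longleftrightarrow> (\<forall>n<2 * d. coeff (\<phi> L) n = 0)"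
    unfolding supersingular_def
    using twisted_kernel_trivial_iff [OF \<open>\<phi> L \<noteq> 0\<close> q_gt_1] by (simp add: degree)
  also have "\<dots> \<longleftrightarrow> poly (p_reduced d) s = 0"
  proof (rule \<phi>_L_purely_inseparable_iff [OF \<alpha>_neq_0 u_eq p_step_def])
    fix i
    show "poly (p_reduced (Suc i)) s =
        (s ^ CARD('a) ^ i - 1) * poly (p_reduced i) s +
        p_step i * s ^ CARD('a) ^ i * (case i of 0 \<Rightarrow> 0 | Suc j \<Rightarrow> poly (p_reduced j) s)"
      by (simp add: poly_monom split: nat.split)
  qed simp
  finally show ?thesis
    by (simp add: s_def map_poly_reduce_p_poly [OF \<alpha>_neq_0])
qed

end
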